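(* The function $\omega:(\Delta(\mathcal{S}(\mathbb{R}_+),\star),\tau^* )\to\mathbb{R}$, where $\omega(m)$ is the unique $s\in\mathbb{R}$ such that $m(f)=\int_0^\infty x^{s-1}f(x)\,dx$ for all $f\in\mathcal{S}(\mathbb{R}_+)$, is continuous (where $\mathbb{R}$ has its standard topology).
   Context: $\mathbb{R}_+=(0,\infty)$, $\mathbb{N}_0=\{0,1,2,\ldots\}$. $\mathcal{S}(\mathbb{R}_+)$ is the real vector space of all $f\in C^\infty(\mathbb{R}_+)$ (real-valued) such that for all $\alpha\in\mathbb{Z}$ and $\beta\in\mathbb{N}_0$ one has $p_{\alpha,\beta}(f) := \sup_{x\in\mathbb{R}_+} |x^\alpha f^{(\beta)}(x)| < \infty$, with the locally convex topology generated by the seminorms $(p_{\alpha,\beta})_{\alpha\in\mathbb{Z},\beta\in\mathbb{N}_0}$. The Mellin convolution of $f,g\in\mathcal{S}(\mathbb{R}_+)$ is the element $f\star g\in\mathcal{S}(\mathbb{R}_+)$ given by $f\star g(x):=\int_0^\infty y^{-1}f(xy^{-1})g(y)\,dy$. The structure space $\Delta(\mathcal{S}(\mathbb{R}_+),\star)$ is the set of all nonzero, linear, continuous functionals $m:\mathcal{S}(\mathbb{R}_+)\to\mathbb{R}$ with $m(f\star g)=m(f)m(g)$ for all $f,g\in\mathcal{S}(\mathbb{R}_+)$. For $s\in\mathbb{R}$ put $m_s(f):=\int_0^\infty x^{s-1}f(x)\,dx$; every $m_s$ belongs to $\Delta(\mathcal{S}(\mathbb{R}_+),\star)$ and every $m\in\Delta(\mathcal{S}(\mathbb{R}_+),\star)$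 equals $m_s$ for a unique $s\in\mathbb{R}$, so $\omega$ is a well-defined bijection. $\tau^*$ is the weak* topology on $\Delta(\mathcal{S}(\mathbb{R}_+),\star)$, i.e. the coarsest topology making all evaluation maps $m\mapsto m(f)$, $f\in\mathcal{S}(\mathbb{R}_+)$, continuous. *)

theory Defs
  imports "HOL-Analysis.Analysis"
begin

text \<open>
  A function on the open half-line is represented by its extension by zero to the whole real
  line, so that functions which agree on the half-line are equal and the pointwise vector space
  operations apply.  All conditions only concern points \<open>x > 0\<close>, where iterated derivatives do
  not depend on the extension.
\<close>

definition mellin_seminorm :: "int \<Rightarrow> nat \<Rightarrow> (real \<Rightarrow> real) \<Rightarrow> real" where
  "mellin_seminorm \<alpha> \<beta> f = (SUP x\<in>{0<..}. \<bar>x powi \<alpha> * (deriv ^^ \<beta>) f x\<bar>)"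

definition schwartz_pos :: "(real \<Rightarrow> real) set" where
  "schwartz_pos = {f.
     (\<forall>x\<le>0. f x = 0) \<and>
     (\<forall>\<beta>. \<forall>x>0. (deriv ^^ \<beta>) f field_differentiable (at x)) \<and>
     (\<forall>\<alpha>::int. \<forall>\<beta>. bdd_above ((\<lambda>x. \<bar>x powi \<alpha> * (deriv ^^ \<beta>) f x\<bar>) ` {0<..}))}"

definition schwartz_pos_topology :: "(real \<Rightarrow> real) topology" where
  "schwartz_pos_topology = topology_generated_by
     {{g \<in> schwartz_pos. mellin_seminorm \<alpha> \<beta> (\<lambda>x. g x - f x) < \<epsilon>} | f \<alpha> \<beta> \<epsilon>.
        f \<in> schwartz_pos \<and> \<epsilon> > 0}"

definition mellin_conv :: "(real \<Rightarrow> real) \<Rightarrow> (real \<Rightarrow> real) \<Rightarrow> real \<Rightarrow> real"  (infixl "\<star>" 70) where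
  "(f \<star> g) x =
     (if x > 0 then (LINT y:{0<..}|lborel. inverse y * f (x * inverse y) * g y) else 0)"

text \<open>Functionals are extensional, so that they are determined by their values on the
  function space.\<close>

definition structure_space :: "((real \<Rightarrow> real) \<Rightarrow> real) set" where
  "structure_space = {m \<in> extensional schwartz_pos.
     (\<exists>f\<in>schwartz_pos. m f \<noteq> 0) \<and>
     (\<forall>f\<in>schwartz_pos. \<forall>g\<in>schwartz_pos. m (\<lambda>x. f x + g x) = m f + m g) \<and>
     (\<forall>c. \<forall>f\<in>schwartz_pos. m (\<lambda>x. c * f x) = c * m f) \<and>
     continuous_map schwartz_pos_topology euclideanreal m \<and>
     (\<forall>f\<in>schwartz_pos. \<forall>g\<in>schwartz_pos. m (f \<star> g) = m f * m g)}"

definition weak_star_topology :: "((real \<Rightarrow> real) \<Rightarrow> real) topology" where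
  "weak_star_topology = topology_generated_by
     {{m \<in> structure_space. m f \<in> U} | f U. f \<in> schwartz_pos \<and> open U}"

definition omega :: "((real \<Rightarrow> real) \<Rightarrow> real) \<Rightarrow> real" where
  "omega m = (THE s. \<forall>f\<in>schwartz_pos. m f = (LINT x:{0<..}|lborel. x powr (s - 1) * f x))"

lemma deriv_funpow_zero: "(deriv ^^ n) (\<lambda>x::real. 0::real) = (\<lambda>x. 0)"
  by (induction n) auto

lemma zero_in_schwartz_pos: "(\<lambda>x. 0) \<in> schwartz_pos"
  by (auto simp: schwartz_pos_def deriv_funpow_zero)

lemma topspace_schwartz_pos_topology: "topspace schwartz_pos_topology = schwartz_pos"
  unfolding schwartz_pos_topology_def topology_generated_by_topspace
proof (rule equalityI, safe)
  fix g assume g: "g \<in> schwartz_pos"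
  then have "g \<in> {h \<in> schwartz_pos. mellin_seminorm 0 0 (\<lambda>x. h x - g x) < 1}"
    by (simp add: mellin_seminorm_def)
  then show "g \<in> \<Union> {{g \<in> schwartz_pos. mellin_seminorm \<alpha> \<beta> (\<lambda>x. g x - f x) < \<epsilon>} | f \<alpha> \<beta> \<epsilon>.
      f \<in> schwartz_pos \<and> \<epsilon> > 0}"
    using g by (intro UnionI[of "{h \<in> schwartz_pos. mellin_seminorm 0 0 (\<lambda>x. h x - g x) < 1}"])
      (rule CollectI, rule exI[of _ g], rule exI[of _ 0], rule exI[of _ 0], rule exI[of _ 1], simp_all)
qed

lemma topspace_weak_star_topology: "topspace weak_star_topology = structure_space"
  unfolding weak_star_topology_def topology_generated_by_topspace
proof (rule equalityI, safe)
  fix m assume "m \<in> structure_space"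
  then show "m \<in> \<Union> {{m \<in> structure_space. m f \<in> U} | f U. f \<in> schwartz_pos \<and> open U}"
    by (intro UnionI[of structure_space], intro CollectI exI[of _ "\<lambda>x. 0"] exI[of _ UNIV])
      (simp_all add: zero_in_schwartz_pos)
qed

lemma continuous_map_weak_star_eval:
  assumes "f \<in> schwartz_pos"
  shows "continuous_map weak_star_topology euclideanreal (\<lambda>m. m f)"
  unfolding continuous_map_def topspace_weak_star_topology
proof (intro conjI allI impI)
  fix U :: "real set" assume "openin euclideanreal U"
  then have "{m \<in> structure_space. m f \<in> U} \<in>
      {{m \<in> structure_space. m f \<in> U} | f U. f \<in> schwartz_pos \<and> open U}"
    using assms by (intro CollectI exI[of _ f] exI[of _ U]) simp
  then show "openin weak_star_topology {m \<in> structure_space. m f \<in> U}"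
    unfolding weak_star_topology_def by (rule topology_generated_by_Basis)
qed simp

lemma weak_star_topology_coarsest:
  assumes X: "topspace X = structure_space"
    and cont: "\<And>f. f \<in> schwartz_pos \<Longrightarrow> continuous_map X euclideanreal (\<lambda>m. m f)"
    and V: "openin weak_star_topology V"
  shows "openin X V"
proof -
  have "generate_topology_on {{m \<in> structure_space. m f \<in> U} | f U. f \<in> schwartz_pos \<and> open U} V"
    using V unfolding weak_star_topology_def openin_topology_generated_by_iff .
  then show ?thesis
  proof (induction rule: generate_topology_on.induct)
    case (Basis s)
    then obtain f U where s: "s = {m \<in> structure_space. m f \<in> U}" and f: "f \<in> schwartz_pos"
      and U: "open U" by blast
    show ?case
      unfolding s X[symmetric]
      by (rule openin_continuous_map_preimage[OF cont[OF f]]) (simp add: U)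
  next
    case (Int a b)
    then show ?case by (intro openin_Int)
  next
    case (UN K)
    then show ?case by (intro openin_Union)
  qed simp
qed

end

theory Submission
  imports Defs
begin

text \<open>
  Everything rests on the Euler operator \<open>D f(x) = x f'(x)\<close>, the infinitesimal dilation.

  Integration by parts shows that \<open>D\<close> can be moved between the two factors of a Mellin convolution
  (\<open>euler_conv_swap\<close>).  Hence a character \<open>m\<close> satisfies \<open>m(D f) m(e) = m(f) m(D e)\<close>, so once some
  \<open>e\<close> with \<open>m(e) \<noteq> 0\<close> is chosen, \<open>m(D f) = - s m(f)\<close> for all \<open>f\<close>, where \<open>s = - m(D e) / m(e)\<close>.
  This number must be the value of \<open>omega\<close> at \<open>m\<close>, because the Mellin transform \<open>M\<^sub>s\<close> at \<open>s\<close> obeys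
  \<open>M\<^sub>s(D f) = - s M\<^sub>s(f)\<close> as well.

  That \<open>m\<close> really is \<open>M\<^sub>s\<close> is seen by inspecting kernels.  By the eigenvalue equation, \<open>m\<close> annihilates
  the range of \<open>D + s\<close>.  The equation \<open>D h + s h = f\<close> is of first order and is solved by
  \<open>h(x) = x\<^sup>-\<^sup>s \<integral>\<^sub>0\<^sup>x t\<^sup>s\<^sup>-\<^sup>1 f(t) dt\<close>, which decays rapidly at infinity too once
  \<open>M\<^sub>s(f) = 0\<close>, and then is again a test function (\<open>euler_inhomogeneous_solution\<close>).  So the
  kernel of \<open>M\<^sub>s\<close> is contained in the kernel of \<open>m\<close>, and \<open>m = c M\<^sub>s\<close> for a constant \<open>c \<noteq> 0\<close>.  Both functionals are multiplicative
  (for \<open>M\<^sub>s\<close> this is Fubini's theorem, \<open>mellin_mellin_conv\<close>), which forces \<open>c = 1\<close>.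

  Consequently \<open>omega m = - m(D e) / m(e)\<close> for every \<open>m\<close> in the weak* open set where
  \<open>m(e) \<noteq> 0\<close>: locally \<open>omega\<close> is a quotient of two evaluation maps, hence continuous.
\<close>

section \<open>Rapid decay at both ends of the half-line\<close>

text \<open>
  Real exponents, instead of the integral ones in the seminorms, are needed because the weight
  \<open>x powr (s - 1)\<close> of the Mellin transform has to be absorbed.
\<close>

definition rapidly_decaying :: "(real \<Rightarrow> real) \<Rightarrow> bool" where
  "rapidly_decaying F \<longleftrightarrow> (\<forall>a::real. \<exists>C. \<forall>x>0. \<bar>x powr a * F x\<bar> \<le> C)"

lemma rapidly_decayingD:
  assumes "rapidly_decaying F"
  obtains C where "C \<ge> 0" "\<And>x. x > 0 \<Longrightarrow> \<bar>x powr a * F x\<bar> \<le> C"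
  using assms unfolding rapidly_decaying_def by (meson abs_ge_zero order_trans zero_less_one)

lemma rapidly_decaying_bounded:
  assumes "rapidly_decaying F"
  obtains C where "C \<ge> 0" "\<And>x. x > 0 \<Longrightarrow> \<bar>F x\<bar> \<le> C"
proof -
  obtain C where "C \<ge> 0" "\<And>x. x > 0 \<Longrightarrow> \<bar>x powr 0 * F x\<bar> \<le> C"
    using rapidly_decayingD[OF assms] by metis
  then show thesis by (intro that[of C]) auto
qed

lemma rapidly_decaying_cong:
  assumes "\<And>x. x > 0 \<Longrightarrow> F x = G x"
  shows "rapidly_decaying F \<longleftrightarrow> rapidly_decaying G"
  using assms unfolding rapidly_decaying_def by simp

lemma rapidly_decaying_add:
  assumes "rapidly_decaying F" "rapidly_decaying G"
  shows "rapidly_decaying (\<lambda>x. F x + G x)"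
  unfolding rapidly_decaying_def
proof
  fix a :: real
  obtain C where C: "\<And>x. x > 0 \<Longrightarrow> \<bar>x powr a * F x\<bar> \<le> C" using rapidly_decayingD[OF assms(1)] by metis
  obtain D where D: "\<And>x. x > 0 \<Longrightarrow> \<bar>x powr a * G x\<bar> \<le> D" using rapidly_decayingD[OF assms(2)] by metis
  show "\<exists>C. \<forall>x>0. \<bar>x powr a * (F x + G x)\<bar> \<le> C"
  proof (intro exI allI impI)
    fix x :: real assume "x > 0"
    then show "\<bar>x powr a * (F x + G x)\<bar> \<le> C + D"
      using C[of x] D[of x] by (simp add: distrib_left)
  qed
qed

lemma rapidly_decaying_powr_mult:
  assumes "rapidly_decaying F"
  shows "rapidly_decaying (\<lambda>x. x powr b * F x)"
  unfolding rapidly_decaying_def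
proof
  fix a :: real
  obtain C where C: "\<And>x. x > 0 \<Longrightarrow> \<bar>x powr (a + b) * F x\<bar> \<le> C" using rapidly_decayingD[OF assms] by metis
  then show "\<exists>C. \<forall>x>0. \<bar>x powr a * (x powr b * F x)\<bar> \<le> C"
    by (intro exI[of _ C]) (simp add: powr_add mult.assoc)
qed

lemma rapidly_decaying_bounded_mult:
  assumes F: "rapidly_decaying F" and B: "\<And>x. x > 0 \<Longrightarrow> \<bar>G x\<bar> \<le> B"
  shows "rapidly_decaying (\<lambda>x. G x * F x)"
  unfolding rapidly_decaying_def
proof
  fix a :: real
  obtain C where C: "\<And>x. x > 0 \<Longrightarrow> \<bar>x powr a * F x\<bar> \<le> C" using rapidly_decayingD[OF F] by metis
  show "\<exists>C. \<forall>x>0. \<bar>x powr a * (G x * F x)\<bar> \<le> C"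
  proof (intro exI allI impI)
    fix x :: real assume x: "x > 0"
    have "\<bar>x powr a * (G x * F x)\<bar> = \<bar>G x\<bar> * \<bar>x powr a * F x\<bar>" by (simp add: abs_mult)
    also have "\<dots> \<le> B * C" using B[OF x] C[OF x] by (intro mult_mono) auto
    finally show "\<bar>x powr a * (G x * F x)\<bar> \<le> B * C" .
  qed
qed

lemma rapidly_decaying_cmult: "rapidly_decaying F \<Longrightarrow> rapidly_decaying (\<lambda>x. c * F x)"
  by (rule rapidly_decaying_bounded_mult[where B="\<bar>c\<bar>"]) auto

lemma rapidly_decaying_abs: "rapidly_decaying F \<Longrightarrow> rapidly_decaying (\<lambda>x. \<bar>F x\<bar>)"
  unfolding rapidly_decaying_def by (simp add: abs_mult)

lemma integrable_inverse_1_plus_square_pos: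
  "set_integrable lborel {0<..} (\<lambda>x::real. inverse (1 + x\<^sup>2))"
proof -
  have "set_integrable lborel (einterval (ereal 0) \<infinity>) (\<lambda>x::real. inverse (1 + x\<^sup>2))"
  proof (rule interval_integral_FTC_nonneg(1))
    show "(arctan has_field_derivative inverse (1 + x\<^sup>2)) (at x)" for x
      by (rule DERIV_arctan)
    show "isCont (\<lambda>x::real. inverse (1 + x\<^sup>2)) x" for x
      by (intro continuous_intros) (simp add: add_nonneg_eq_0_iff)
    have "isCont arctan 0" by (rule isCont_arctan)
    then have "(arctan \<longlongrightarrow> 0) (at_right 0)"
      by (simp add: isCont_def tendsto_within_subset[of _ _ _ UNIV])
    then show "((arctan \<circ> real_of_ereal) \<longlongrightarrow> 0) (at_right (ereal 0))"
      unfolding ereal_tendsto_simps .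
    show "((arctan \<circ> real_of_ereal) \<longlongrightarrow> pi / 2) (at_left \<infinity>)"
      unfolding ereal_tendsto_simps by (rule tendsto_arctan_at_top)
  qed (simp_all add: add_nonneg_nonneg)
  then show ?thesis by (simp del: zero_ereal_def)
qed

text \<open>
  The bounds with exponents 0 and 2 together dominate the function by a multiple of the
  derivative of the arctangent.
\<close>

lemma rapidly_decaying_integrable:
  assumes F: "rapidly_decaying F" and cont: "continuous_on {0<..} F"
  shows "set_integrable lborel {0<..} F"
proof -
  obtain C where C: "C \<ge> 0" "\<And>x. x > 0 \<Longrightarrow> \<bar>F x\<bar> \<le> C"
    using rapidly_decaying_bounded[OF F] by metis
  obtain D where D: "D \<ge> 0" "\<And>x. x > 0 \<Longrightarrow> \<bar>x powr 2 * F x\<bar> \<le> D"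
    using rapidly_decayingD[OF F] by metis
  have bnd: "set_integrable lborel {0<..} (\<lambda>x. (C + D) * inverse (1 + x^2))"
    by (intro set_integrable_mult_right integrable_inverse_1_plus_square_pos)
  show ?thesis
  proof (rule set_integrable_bound[OF bnd])
    show "set_borel_measurable lborel {0<..} F"
      unfolding set_borel_measurable_def
      using borel_measurable_continuous_on_indicator[OF _ cont] by simp
    show "AE x in lborel. x \<in> {0<..} \<longrightarrow> norm (F x) \<le> norm ((C + D) * inverse (1 + x^2))"
    proof (intro AE_I2 impI)
      fix x :: real assume "x \<in> {0<..}"
      then have x: "x > 0" by simp
      have "(1 + x^2) * \<bar>F x\<bar> \<le> C + D"
        using C(2)[OF x] D(2)[OF x] x by (simp add: distrib_right abs_mult)
      then have "\<bar>F x\<bar> \<le> (C + D) / (1 + x^2)"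
        by (subst pos_le_divide_eq) (auto simp: mult.commute add_pos_nonneg)
      then show "norm (F x) \<le> norm ((C + D) * inverse (1 + x^2))"
        using C D by (simp add: divide_inverse abs_mult)
    qed
  qed
qed

lemma rapidly_decaying_tendsto_0:
  assumes "rapidly_decaying F"
  shows "(F \<longlongrightarrow> 0) (at_right 0)" "(F \<longlongrightarrow> 0) at_top"
proof -
  obtain C where C: "\<And>x. x > 0 \<Longrightarrow> \<bar>x powr (-1) * F x\<bar> \<le> C" using rapidly_decayingD[OF assms] by metis
  obtain D where D: "\<And>x. x > 0 \<Longrightarrow> \<bar>x powr 1 * F x\<bar> \<le> D" using rapidly_decayingD[OF assms] by metis
  have "((\<lambda>x. C * x) \<longlongrightarrow> C * 0) (at_right 0)" by (intro tendsto_intros)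
  moreover have "\<forall>\<^sub>F x in at_right 0. norm (F x) \<le> C * x"
    using eventually_at_right_less[of 0]
  proof eventually_elim
    case (elim x)
    then show ?case using C[of x] by (simp add: powr_minus abs_mult divide_simps)
  qed
  ultimately show "(F \<longlongrightarrow> 0) (at_right 0)" by (intro Lim_null_comparison[of F]) auto
  have "((\<lambda>x. D / x) \<longlongrightarrow> 0) at_top" 
    by (rule real_tendsto_divide_at_top[OF tendsto_const filterlim_ident])
  moreover have "\<forall>\<^sub>F x in at_top. norm (F x) \<le> D / x"
    using eventually_gt_at_top[of 0]
  proof eventually_elim
    case (elim x)
    then show ?case using D[of x] by (simp add: abs_mult divide_simps mult.commute)
  qed
  ultimately show "(F \<longlongrightarrow> 0) at_top" by (intro Lim_null_comparison[of F]) auto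
qed

text \<open>
  This is integration by parts without boundary terms: products are differentiated under the
  integral, and the resulting sum integrates to zero.
\<close>

lemma integral_deriv_rapidly_decaying:
  assumes deriv: "\<And>x. x > 0 \<Longrightarrow> (F has_field_derivative F' x) (at x)"
    and cont: "continuous_on {0<..} F'"
    and F: "rapidly_decaying F" and F': "rapidly_decaying F'"
  shows "(LINT x:{0<..}|lborel. F' x) = 0"
proof -
  have "(LBINT x=ereal 0..\<infinity>. F' x) = 0 - 0"
  proof (rule interval_integral_FTC_integrable)
    show "(F has_vector_derivative F' x) (at x)" if "ereal 0 < ereal x" for x
      using deriv[of x] that by (simp add: has_real_derivative_iff_has_vector_derivative)
    show "isCont F' x" if "ereal 0 < ereal x" for x
      using cont that by (simp add: continuous_on_eq_continuous_at open_greaterThan)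
    show "set_integrable lborel (einterval (ereal 0) \<infinity>) F'"
      using rapidly_decaying_integrable[OF F' cont] by (simp del: zero_ereal_def)
    show "((F \<circ> real_of_ereal) \<longlongrightarrow> 0) (at_right (ereal 0))"
      using rapidly_decaying_tendsto_0[OF F] unfolding ereal_tendsto_simps by simp
    show "((F \<circ> real_of_ereal) \<longlongrightarrow> 0) (at_left \<infinity>)"
      using rapidly_decaying_tendsto_0[OF F] unfolding ereal_tendsto_simps by simp
  qed simp
  then show ?thesis by (simp add: interval_integral_to_infinity_eq)
qed

section \<open>The space of test functions and the Euler operator\<close>

definition euler :: "(real \<Rightarrow> real) \<Rightarrow> real \<Rightarrow> real" where
  "euler f x = x * deriv f x"

text \<open>
  A real power is dominated by the sum of the two integral powers next to it: the larger exponent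
  takes care of \<open>x \<ge> 1\<close> and the smaller one of \<open>x < 1\<close>.
\<close>

lemma schwartz_pos_iff:
  "f \<in> schwartz_pos \<longleftrightarrow> (\<forall>x\<le>0. f x = 0) \<and>
     (\<forall>n. \<forall>x>0. (deriv ^^ n) f field_differentiable (at x)) \<and>
     (\<forall>n. rapidly_decaying ((deriv ^^ n) f))"
proof -
  have powi_iff: "(\<forall>\<alpha>::int. bdd_above ((\<lambda>x. \<bar>x powi \<alpha> * F x\<bar>) ` {0<..})) \<longleftrightarrow> rapidly_decaying F" (is "?L \<longleftrightarrow> _")
    for F :: "real \<Rightarrow> real"
  proof
    assume ?L
    show "rapidly_decaying F" unfolding rapidly_decaying_def
    proof
      fix a :: real
      from \<open>?L\<close> obtain C where C: "\<And>x. x > 0 \<Longrightarrow> \<bar>x powi \<lfloor>a\<rfloor> * F x\<bar> \<le> C"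
        unfolding bdd_above_def by (metis (mono_tags, lifting) greaterThan_iff image_eqI)
      from \<open>?L\<close> obtain D where D: "\<And>x. x > 0 \<Longrightarrow> \<bar>x powi \<lceil>a\<rceil> * F x\<bar> \<le> D"
        unfolding bdd_above_def by (metis (mono_tags, lifting) greaterThan_iff image_eqI)
      show "\<exists>C. \<forall>x>0. \<bar>x powr a * F x\<bar> \<le> C"
      proof (intro exI allI impI)
        fix x :: real assume x: "x > 0"
        have "x powr a \<le> x powr \<lfloor>a\<rfloor> + x powr \<lceil>a\<rceil>"
        proof (cases "x \<ge> 1")
          case True
          then have "x powr a \<le> x powr \<lceil>a\<rceil>" by (intro powr_mono) auto
          then show ?thesis by (simp add: add_increasing)
        next
          case False
          then have "x powr a \<le> x powr \<lfloor>a\<rfloor>" using x by (intro powr_mono') auto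
          then show ?thesis by (simp add: add_increasing2)
        qed
        then have "\<bar>x powr a * F x\<bar> \<le> (x powr \<lfloor>a\<rfloor> + x powr \<lceil>a\<rceil>) * \<bar>F x\<bar>"
          by (simp add: abs_mult mult_right_mono)
        also have "\<dots> = \<bar>x powi \<lfloor>a\<rfloor> * F x\<bar> + \<bar>x powi \<lceil>a\<rceil> * F x\<bar>"
          using x by (simp add: powr_real_of_int' abs_mult distrib_right)
        also have "\<dots> \<le> C + D" using C[OF x] D[OF x] by simp
        finally show "\<bar>x powr a * F x\<bar> \<le> C + D" .
      qed
    qed
  next
    assume F: "rapidly_decaying F"
    show ?L
    proof
      fix \<alpha> :: int
      obtain C where C: "\<And>x. x > 0 \<Longrightarrow> \<bar>x powr of_int \<alpha> * F x\<bar> \<le> C" using rapidly_decayingD[OF F] by metis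
      then show "bdd_above ((\<lambda>x. \<bar>x powi \<alpha> * F x\<bar>) ` {0<..})"
        by (intro bdd_aboveI2[of _ _ C]) (auto simp: powr_real_of_int')
    qed
  qed
  show ?thesis unfolding schwartz_pos_def mem_Collect_eq powi_iff[symmetric] by (metis (lifting))
qed

lemma schwartz_pos_zero: "f \<in> schwartz_pos \<Longrightarrow> x \<le> 0 \<Longrightarrow> f x = 0"
  by (simp add: schwartz_pos_iff)

lemma schwartz_pos_higher_DERIV:
  "f \<in> schwartz_pos \<Longrightarrow> x > 0 \<Longrightarrow> ((deriv ^^ n) f has_field_derivative (deriv ^^ Suc n) f x) (at x)"
  by (simp add: schwartz_pos_iff DERIV_deriv_iff_field_differentiable)

lemma schwartz_pos_higher_decaying: "f \<in> schwartz_pos \<Longrightarrow> rapidly_decaying ((deriv ^^ n) f)"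
  by (simp add: schwartz_pos_iff)

lemmas schwartz_pos_DERIV = schwartz_pos_higher_DERIV[where n=0, simplified]
lemmas schwartz_pos_decaying = schwartz_pos_higher_decaying[where n=0, simplified]
lemmas schwartz_pos_deriv_decaying = schwartz_pos_higher_decaying[where n=1, simplified]

lemma schwartz_pos_continuous: "f \<in> schwartz_pos \<Longrightarrow> continuous_on {0<..} f"
  by (rule DERIV_continuous_on[where D="deriv f"], rule has_field_derivative_at_within,
      rule schwartz_pos_DERIV) simp_all

lemma schwartz_pos_measurable [measurable]:
  assumes "f \<in> schwartz_pos"
  shows "f \<in> borel_measurable borel"
proof -
  have "(\<lambda>x. indicator {0<..} x *\<^sub>R f x) \<in> borel_measurable borel"
    by (intro borel_measurable_continuous_on_indicator schwartz_pos_decaying schwartz_pos_continuous assms) auto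
  also have "(\<lambda>x. indicator {0<..} x *\<^sub>R f x) = f"
    using schwartz_pos_zero[OF assms] by (auto simp: fun_eq_iff indicator_def)
  finally show ?thesis .
qed

lemma has_field_derivative_cong_pos:
  fixes F G :: "real \<Rightarrow> real"
  assumes "\<And>y. y > 0 \<Longrightarrow> F y = G y" "x > 0" "(G has_field_derivative D) (at x)"
  shows "(F has_field_derivative D) (at x)"
  by (rule has_field_derivative_transform_within_open[OF assms(3), of "{0<..}"]) (use assms in auto)

lemma higher_deriv_lincomb:
  assumes f: "f \<in> schwartz_pos" and g: "g \<in> schwartz_pos" and x: "x > 0"
  shows "(deriv ^^ n) (\<lambda>x. c * f x + g x) x = c * (deriv ^^ n) f x + (deriv ^^ n) g x"
  using x
proof (induction n arbitrary: x)
  case (Suc n)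
  have "((deriv ^^ n) (\<lambda>x. c * f x + g x) has_field_derivative
      c * (deriv ^^ Suc n) f x + (deriv ^^ Suc n) g x) (at x)"
    by (rule has_field_derivative_cong_pos[OF Suc.IH Suc.prems], assumption)
      (rule DERIV_add[OF DERIV_cmult[OF schwartz_pos_higher_DERIV[OF f Suc.prems]]
        schwartz_pos_higher_DERIV[OF g Suc.prems]])
  then show ?case by (simp add: DERIV_imp_deriv)
qed simp

lemma schwartz_pos_lincomb:
  assumes f: "f \<in> schwartz_pos" and g: "g \<in> schwartz_pos"
  shows "(\<lambda>x. c * f x + g x) \<in> schwartz_pos"
  unfolding schwartz_pos_iff
proof (intro conjI allI impI)
  note eq = higher_deriv_lincomb[OF f g]
  show "c * f x + g x = 0" if "x \<le> 0" for x
    using schwartz_pos_zero[OF f that] schwartz_pos_zero[OF g that] by simp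
  fix n
  show "(deriv ^^ n) (\<lambda>x. c * f x + g x) field_differentiable at x" if "x > 0" for x
    unfolding field_differentiable_def
    by (rule exI[of _ "c * (deriv ^^ Suc n) f x + (deriv ^^ Suc n) g x"],
        rule has_field_derivative_cong_pos[OF eq that], assumption)
      (rule DERIV_add[OF DERIV_cmult[OF schwartz_pos_higher_DERIV[OF f that]] schwartz_pos_higher_DERIV[OF g that]])
  show "rapidly_decaying ((deriv ^^ n) (\<lambda>x. c * f x + g x))"
    by (subst rapidly_decaying_cong, erule eq)
      (rule rapidly_decaying_add[OF rapidly_decaying_cmult[OF schwartz_pos_higher_decaying[OF f]]
        schwartz_pos_higher_decaying[OF g]])
qed

text \<open>Each differentiation commutes with the Euler operator up to one copy of itself.\<close>

lemma higher_deriv_euler: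
  assumes f: "f \<in> schwartz_pos" and x: "x > 0"
  shows "(deriv ^^ n) (euler f) x = x * (deriv ^^ Suc n) f x + real n * (deriv ^^ n) f x"
  using x
proof (induction n arbitrary: x)
  case (Suc n)
  have "((deriv ^^ n) (euler f) has_field_derivative
      (1 * (deriv ^^ Suc n) f x + (deriv ^^ Suc (Suc n)) f x * x) + real n * (deriv ^^ Suc n) f x) (at x)"
    by (rule has_field_derivative_cong_pos[OF Suc.IH Suc.prems], assumption)
      (rule DERIV_add[OF DERIV_mult[OF DERIV_ident schwartz_pos_higher_DERIV[OF f Suc.prems]]
        DERIV_cmult[OF schwartz_pos_higher_DERIV[OF f Suc.prems]]])
  then show ?case by (simp add: DERIV_imp_deriv algebra_simps)
qed (simp add: euler_def)

lemma euler_nonpos: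
  assumes zero: "\<And>x. x \<le> 0 \<Longrightarrow> f x = 0" and x: "x \<le> 0"
  shows "euler f x = 0"
proof (cases "x = 0")
  case False
  have "(f has_field_derivative 0) (at x)"
    by (rule has_field_derivative_transform_within_open[OF DERIV_const, of "{..<0}"])
      (use x False zero in auto)
  then have "deriv f x = 0" by (rule DERIV_imp_deriv)
  then show ?thesis by (simp add: euler_def)
qed (simp add: euler_def)

lemma schwartz_pos_euler:
  assumes f: "f \<in> schwartz_pos"
  shows "euler f \<in> schwartz_pos"
  unfolding schwartz_pos_iff
proof (intro conjI allI impI)
  note eq = higher_deriv_euler[OF f]
  show "euler f x = 0" if "x \<le> 0" for x using euler_nonpos[OF schwartz_pos_zero[OF f] that] .
  fix n
  show "(deriv ^^ n) (euler f) field_differentiable at x" if "x > 0" for x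
    unfolding field_differentiable_def
    by (rule exI[of _ "(1 * (deriv ^^ Suc n) f x + (deriv ^^ Suc (Suc n)) f x * x) + real n * (deriv ^^ Suc n) f x"],
        rule has_field_derivative_cong_pos[OF eq that], assumption)
      (rule DERIV_add[OF DERIV_mult[OF DERIV_ident schwartz_pos_higher_DERIV[OF f that]]
        DERIV_cmult[OF schwartz_pos_higher_DERIV[OF f that]]])
  have "rapidly_decaying (\<lambda>x. x powr 1 * (deriv ^^ Suc n) f x + real n * (deriv ^^ n) f x)"
    by (rule rapidly_decaying_add[OF rapidly_decaying_powr_mult[OF schwartz_pos_higher_decaying[OF f]]
      rapidly_decaying_cmult[OF schwartz_pos_higher_decaying[OF f]]])
  also have "?this \<longleftrightarrow> rapidly_decaying ((deriv ^^ n) (euler f))"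
    by (rule rapidly_decaying_cong) (simp add: eq del: funpow.simps)
  finally show "rapidly_decaying ((deriv ^^ n) (euler f))" .
qed

text \<open>
  If \<open>F\<^sup>(\<^sup>n\<^sup>) = x\<^sup>-\<^sup>n H\<close>, then \<open>F\<^sup>(\<^sup>n\<^sup>+\<^sup>1\<^sup>) = x\<^sup>-\<^sup>n\<^sup>-\<^sup>1 (D H - n H)\<close>.  A class of rapidly decaying functions
  closed under the operators \<open>D - n\<close> therefore controls all derivatives of its members.  For
  convolutions and for solutions of the Euler equation such a class is visible at once, whereas
  formulas for their \<open>n\<close>-th derivatives are not.
\<close>

lemma schwartz_pos_coinduct:
  assumes F: "F \<in> K"
    and zero: "\<And>F x. F \<in> K \<Longrightarrow> x \<le> 0 \<Longrightarrow> F x = 0"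
    and diff: "\<And>F x. F \<in> K \<Longrightarrow> x > 0 \<Longrightarrow> F field_differentiable (at x)"
    and decay: "\<And>F. F \<in> K \<Longrightarrow> rapidly_decaying F"
    and step: "\<And>F n. F \<in> K \<Longrightarrow> \<exists>H\<in>K. \<forall>x>0. H x = euler F x - real n * F x"
  shows "F \<in> schwartz_pos"
proof -
  have ex: "\<exists>H\<in>K. \<forall>x>0. (deriv ^^ n) F x = x powr - real n * H x" for n
  proof (induction n)
    case 0
    then show ?case using F by auto
  next
    case (Suc n)
    then obtain H where H: "H \<in> K" "\<And>x. x > 0 \<Longrightarrow> (deriv ^^ n) F x = x powr - real n * H x" by blast
    obtain G where G: "G \<in> K" "\<And>x. x > 0 \<Longrightarrow> G x = euler H x - real n * H x" using step[OF H(1)] by blast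
    have "(deriv ^^ Suc n) F x = x powr - real (Suc n) * G x" if x: "x > 0" for x
    proof -
      have "((deriv ^^ n) F has_field_derivative
          - real n * x powr (- real n - 1) * H x + deriv H x * x powr - real n) (at x)"
        by (rule has_field_derivative_cong_pos[OF H(2) x], assumption)
          (use diff[OF H(1) x] x in \<open>intro DERIV_mult has_real_derivative_powr,
            auto simp: DERIV_deriv_iff_field_differentiable\<close>)
      then have "(deriv ^^ Suc n) F x = - real n * x powr (- real n - 1) * H x + deriv H x * x powr - real n"
        by (simp add: DERIV_imp_deriv)
      also have "x powr - real n = x powr (- real n - 1) * x"
        using x by (simp add: powr_diff)
      also have "- real n * x powr (- real n - 1) * H x + deriv H x * (x powr (- real n - 1) * x)
          = x powr (- real n - 1) * G x"
        unfolding G(2)[OF x] euler_def by (simp add: algebra_simps)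
      also have "- real n - 1 = - real (Suc n)" by simp
      finally show ?thesis .
    qed
    then show ?case using G(1) by blast
  qed
  show ?thesis
    unfolding schwartz_pos_iff
  proof (intro conjI allI impI)
    show "F x = 0" if "x \<le> 0" for x using zero[OF F that] .
    fix n
    obtain H where H: "H \<in> K" "\<And>x. x > 0 \<Longrightarrow> (deriv ^^ n) F x = x powr - real n * H x" using ex by blast
    show "rapidly_decaying ((deriv ^^ n) F)"
      by (subst rapidly_decaying_cong, erule H(2)) (rule rapidly_decaying_powr_mult[OF decay[OF H(1)]])
    show "(deriv ^^ n) F field_differentiable at x" if x: "x > 0" for x
    proof -
      have "(H has_field_derivative deriv H x) (at x)"
        using diff[OF H(1) x] by (simp add: DERIV_deriv_iff_field_differentiable)
      have "((deriv ^^ n) F has_field_derivative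
          - real n * x powr (- real n - 1) * H x + deriv H x * x powr - real n) (at x)"
        by (rule has_field_derivative_cong_pos[OF H(2) x], assumption)
          (rule DERIV_mult[OF has_real_derivative_powr[OF x] \<open>(H has_field_derivative deriv H x) (at x)\<close>])
      then show ?thesis
        unfolding field_differentiable_def by blast
    qed
  qed
qed

section \<open>The Mellin transform\<close>

definition mellin :: "real \<Rightarrow> (real \<Rightarrow> real) \<Rightarrow> real" where
  "mellin s f = (LINT x:{0<..}|lborel. x powr (s - 1) * f x)"

lemma powr_mult_integrable:
  assumes "rapidly_decaying F" "continuous_on {0<..} F"
  shows "set_integrable lborel {0<..} (\<lambda>x. x powr a * F x)"
  by (intro rapidly_decaying_integrable rapidly_decaying_powr_mult continuous_intros assms) auto

lemma mellin_integrable: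
  "f \<in> schwartz_pos \<Longrightarrow> set_integrable lborel {0<..} (\<lambda>x. x powr a * f x)"
  by (intro powr_mult_integrable schwartz_pos_decaying schwartz_pos_continuous)

lemma mellin_lincomb:
  assumes "f \<in> schwartz_pos" "g \<in> schwartz_pos"
  shows "mellin s (\<lambda>x. c * f x + g x) = c * mellin s f + mellin s g"
proof -
  have "mellin s (\<lambda>x. c * f x + g x) =
      (LINT x:{0<..}|lborel. c * (x powr (s - 1) * f x) + x powr (s - 1) * g x)"
    unfolding mellin_def by (simp add: algebra_simps)
  also have "\<dots> = c * mellin s f + mellin s g"
    unfolding mellin_def
    by (subst set_integral_add) (simp_all add: mellin_integrable assms)
  finally show ?thesis .
qed

lemma mellin_euler:
  assumes f: "f \<in> schwartz_pos"
  shows "mellin s (euler f) = - s * mellin s f"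
proof -
  note ef = schwartz_pos_euler[OF f]
  have "(LINT x:{0<..}|lborel. s * (x powr (s - 1) * f x) + x powr (s - 1) * euler f x) = 0"
  proof (rule integral_deriv_rapidly_decaying)
    show "((\<lambda>x. x powr s * f x) has_field_derivative
        s * (x powr (s - 1) * f x) + x powr (s - 1) * euler f x) (at x)" if "x > 0" for x
      using DERIV_mult[OF has_real_derivative_powr[OF that] schwartz_pos_DERIV[OF f that], of s]
      by (rule DERIV_cong) (use that in \<open>simp add: euler_def powr_diff\<close>)
    show "continuous_on {0<..} (\<lambda>x. s * (x powr (s - 1) * f x) + x powr (s - 1) * euler f x)"
      by (intro continuous_intros schwartz_pos_decaying schwartz_pos_continuous f ef) auto
    show "rapidly_decaying (\<lambda>x. x powr s * f x)"
      by (rule rapidly_decaying_powr_mult[OF schwartz_pos_decaying[OF f]])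
    show "rapidly_decaying (\<lambda>x. s * (x powr (s - 1) * f x) + x powr (s - 1) * euler f x)"
      by (rule rapidly_decaying_add[OF
          rapidly_decaying_cmult[OF rapidly_decaying_powr_mult[OF schwartz_pos_decaying[OF f]]]
          rapidly_decaying_powr_mult[OF schwartz_pos_decaying[OF ef]]])
  qed
  then have "s * mellin s f + mellin s (euler f) = 0"
    unfolding mellin_def
    by (subst (asm) set_integral_add) (simp_all add: mellin_integrable f ef)
  then show ?thesis by simp
qed

text \<open>
  An outer power \<open>x\<^sup>a\<close> can be moved into the integral where it is at most \<open>t\<^sup>a\<close>; the resulting
  bound depends neither on \<open>x\<close> nor on the domain of integration.  It is applied to initial segments
  when \<open>a \<le> 0\<close> and to final segments when \<open>a \<ge> 0\<close>.
\<close>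

lemma powr_times_partial_integral_le:
  assumes f: "f \<in> schwartz_pos" and A: "A \<in> sets borel" "A \<subseteq> {0<..}"
    and le: "\<And>t. t \<in> A \<Longrightarrow> x powr a \<le> t powr a"
  shows "\<bar>x powr a * (LINT t:A|lborel. t powr b * f t)\<bar> \<le> (LINT t:{0<..}|lborel. t powr (a + b) * \<bar>f t\<bar>)"
proof -
  have "\<bar>x powr a * (LINT t:A|lborel. t powr b * f t)\<bar> = norm (LINT t:A|lborel. x powr a * (t powr b * f t))"
    by simp
  also have "\<dots> \<le> (LINT t:{0<..}|lborel. t powr (a + b) * \<bar>f t\<bar>)"
    unfolding set_lebesgue_integral_def
  proof (rule Bochner_Integration.integral_norm_bound_integral)
    have "set_integrable lborel A (\<lambda>t. x powr a * (t powr b * f t))"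
      by (intro set_integrable_mult_right set_integrable_subset[OF mellin_integrable[OF f]])
        (use A in auto)
    then show "integrable lborel (\<lambda>t. indicat_real A t *\<^sub>R (x powr a * (t powr b * f t)))"
      unfolding set_integrable_def .
    have "set_integrable lborel {0<..} (\<lambda>t. t powr (a + b) * \<bar>f t\<bar>)"
      by (intro powr_mult_integrable rapidly_decaying_abs continuous_intros schwartz_pos_decaying schwartz_pos_continuous f)
    then show "integrable lborel (\<lambda>t. indicat_real {0<..} t *\<^sub>R (t powr (a + b) * \<bar>f t\<bar>))"
      unfolding set_integrable_def .
    fix t
    show "norm (indicat_real A t *\<^sub>R (x powr a * (t powr b * f t)))
        \<le> indicat_real {0<..} t *\<^sub>R (t powr (a + b) * \<bar>f t\<bar>)"
    proof (cases "t \<in> A")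
      case True
      then have "t > 0" using A by auto
      have "x powr a * (t powr b * \<bar>f t\<bar>) \<le> t powr a * (t powr b * \<bar>f t\<bar>)"
        using le[OF True] by (intro mult_right_mono) auto
      then show ?thesis using True \<open>t > 0\<close> by (simp add: abs_mult powr_add mult.assoc)
    qed (simp add: indicator_def)
  qed
  finally show ?thesis .
qed

text \<open>
  Variation of constants: \<open>x\<^sup>s h\<close> must be a primitive of \<open>x\<^sup>s\<^sup>-\<^sup>1 f\<close>.  The primitive starting at 0 decays
  at 0; since the total integral vanishes, it is also minus the integral over the final segment and
  decays at infinity.
\<close>

lemma euler_inhomogeneous_solution:
  assumes f: "f \<in> schwartz_pos" and m0: "mellin s f = 0"
  obtains h where "h \<in> schwartz_pos" "\<And>x. f x = euler h x + s * h x"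
proof -
  define k where "k t = t powr (s - 1) * f t" for t
  define P where "P x = (LINT t:{0<..x}|lborel. k t)" for x
  define h where "h x = (if x > 0 then x powr - s * P x else 0)" for x
  have k_int: "set_integrable lborel A k" if "A \<in> sets borel" "A \<subseteq> {0<..}" for A
    unfolding k_def by (rule set_integrable_subset[OF mellin_integrable[OF f]]) (use that in auto)
  have tail: "P x = - (LINT t:{x<..}|lborel. k t)" if "x > 0" for x
  proof -
    have "0 = (LINT t:{0<..}|lborel. k t)" using m0 by (simp add: mellin_def k_def)
    also have "{0<..} = {0<..x} \<union> {x<..}" using that by auto
    also have "(LINT t:\<dots>|lborel. k t) = P x + (LINT t:{x<..}|lborel. k t)"
      unfolding P_def by (rule set_integral_Un) (use that in \<open>auto intro: k_int\<close>)
    finally show ?thesis by simp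
  qed
  have h_decay: "rapidly_decaying h"
    unfolding rapidly_decaying_def
  proof
    fix a :: real
    define b where "b = a - s"
    show "\<exists>C. \<forall>x>0. \<bar>x powr a * h x\<bar> \<le> C"
    proof (intro exI allI impI)
      fix x :: real assume x: "x > 0"
      have "\<bar>x powr a * h x\<bar> = \<bar>x powr b * P x\<bar>"
        using x by (simp add: h_def b_def powr_diff powr_minus field_simps)
      also have "\<dots> \<le> (LINT t:{0<..}|lborel. t powr (b + (s - 1)) * \<bar>f t\<bar>)"
      proof (cases "b \<ge> 0")
        case True
        have "\<bar>x powr b * P x\<bar> = \<bar>x powr b * (LINT t:{x<..}|lborel. t powr (s - 1) * f t)\<bar>"
          using tail[OF x] by (simp add: k_def)
        also have "\<dots> \<le> (LINT t:{0<..}|lborel. t powr (b + (s - 1)) * \<bar>f t\<bar>)"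
          using x True by (intro powr_times_partial_integral_le f powr_mono2) auto
        finally show ?thesis .
      next
        case False
        then show ?thesis
          unfolding P_def k_def by (intro powr_times_partial_integral_le f powr_mono2') auto
      qed
      finally show "\<bar>x powr a * h x\<bar> \<le> (LINT t:{0<..}|lborel. t powr (b + (s - 1)) * \<bar>f t\<bar>)" .
    qed
  qed
  \<comment> \<open>Continuity of the integrand is at hand on the open half-line only, while the primitive starts
    at 0; so the form of the fundamental theorem is used that asks for continuity at the point of
    differentiation.\<close>
  have P_deriv: "(P has_field_derivative k x) (at x)" if x: "x > 0" for x
  proof -
    have P_eq: "P u = integral {0..u} k" for u
    proof -
      have "P u = integral {0<..u} k"
        unfolding P_def by (rule set_borel_integral_eq_integral) (auto intro: k_int)
      also have "\<dots> = integral {0..u} k"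
      proof (rule integral_spike_set)
        show "negligible {x \<in> {0<..u} - {0..u}. k x \<noteq> 0}" by (rule negligible_subset[of "{}"]) auto
        show "negligible {x \<in> {0..u} - {0<..u}. k x \<noteq> 0}" by (rule negligible_subset[of "{0}"]) auto
      qed
      finally show ?thesis .
    qed
    have "set_integrable lborel {0<..2 * x} k" by (auto intro: k_int)
    then have "k integrable_on {0<..2 * x}" by (rule set_borel_integral_eq_integral)
    then have k_HK: "k integrable_on {0..2 * x}"
      by (rule integrable_spike_set) (rule negligible_subset[of "{0}"], auto)+
    have "continuous_on {0<..} k"
      unfolding k_def by (intro continuous_intros schwartz_pos_decaying schwartz_pos_continuous f) auto
    then have "isCont k x"
      using x continuous_on_eq_continuous_at[OF open_greaterThan] by blast
    then have cont: "continuous (at x within ({0..2 * x} - {})) k"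
      by (rule continuous_at_imp_continuous_at_within)
    have "x \<in> {0..2 * x} - {}" using x by simp
    from integral_has_vector_derivative_continuous_at[OF k_HK this finite.emptyI cont]
    have "((\<lambda>u. integral {0..u} k) has_vector_derivative k x) (at x within {0..2 * x})"
      by (simp only: Diff_empty)
    then have "((\<lambda>u. integral {0..u} k) has_field_derivative k x) (at x)"
      using x by (simp add: has_real_derivative_iff_has_vector_derivative at_within_Icc_at)
    then show ?thesis unfolding P_eq[abs_def] .
  qed
  have h_deriv: "(h has_field_derivative (f x - s * h x) / x) (at x)" if x: "x > 0" for x
  proof -
    have "((\<lambda>x. x powr - s * P x) has_field_derivative
        - s * x powr (- s - 1) * P x + k x * x powr - s) (at x)"
      by (rule DERIV_mult[OF has_real_derivative_powr[OF x] P_deriv[OF x]])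
    then have "(h has_field_derivative - s * x powr (- s - 1) * P x + k x * x powr - s) (at x)"
      by (rule has_field_derivative_cong_pos[OF _ x, rotated]) (simp add: h_def)
    then show ?thesis
      by (rule DERIV_cong) (use x in \<open>simp add: h_def k_def powr_diff powr_minus field_simps\<close>)
  qed
  have eqn: "f x = euler h x + s * h x" for x
  proof (cases "x > 0")
    case True
    then show ?thesis using DERIV_imp_deriv[OF h_deriv[OF True]] by (simp add: euler_def)
  next
    case False
    then have "euler h x = 0" by (intro euler_nonpos) (auto simp: h_def)
    then show ?thesis using False schwartz_pos_zero[OF f, of x] by (simp add: h_def)
  qed
  \<comment> \<open>The Euler equation turns \<open>D h\<close> into a combination of \<open>h\<close> and \<open>f\<close>, so this class is closed
    under \<open>D - n\<close>.\<close>
  define K where "K = {(\<lambda>x. c * h x + g x) | c g. g \<in> schwartz_pos}"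
  have "h \<in> schwartz_pos"
  proof (rule schwartz_pos_coinduct[of _ K])
    show "h \<in> K"
      unfolding K_def mem_Collect_eq
      by (intro exI[of _ 1] exI[of _ "\<lambda>x. 0"]) (simp add: zero_in_schwartz_pos)
  next
    fix F assume "F \<in> K"
    then obtain c g where F: "F = (\<lambda>x. c * h x + g x)" and g: "g \<in> schwartz_pos"
      unfolding K_def by blast
    show "F x = 0" if "x \<le> 0" for x
      using that schwartz_pos_zero[OF g] by (simp add: F h_def)
    have F_deriv: "(F has_field_derivative c * ((f x - s * h x) / x) + deriv g x) (at x)" if "x > 0" for x
      unfolding F by (intro DERIV_add DERIV_cmult h_deriv schwartz_pos_DERIV g that)
    then show "F field_differentiable at x" if "x > 0" for x
      using that by (auto simp: field_differentiable_def)
    show "rapidly_decaying F"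
      unfolding F by (rule rapidly_decaying_add[OF rapidly_decaying_cmult[OF h_decay] schwartz_pos_decaying[OF g]])
    fix n
    define G where "G x = c * f x + (- real n * g x + euler g x)" for x
    have "G \<in> schwartz_pos"
      unfolding G_def[abs_def] by (intro schwartz_pos_lincomb f g schwartz_pos_euler)
    then have G: "(\<lambda>x. (- s - real n) * c * h x + G x) \<in> K" unfolding K_def by blast
    show "\<exists>H\<in>K. \<forall>x>0. H x = euler F x - real n * F x"
    proof (rule bexI[OF _ G], intro allI impI)
      fix x :: real assume "x > 0"
      then show "(- s - real n) * c * h x + G x = euler F x - real n * F x"
        using DERIV_imp_deriv[OF F_deriv[of x]] unfolding euler_def
        by (simp add: F G_def euler_def field_simps)
    qed
  qed
  then show thesis by (rule that[OF _ eqn])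
qed

section \<open>The Mellin convolution\<close>

lemma mellin_kernel_continuous:
  assumes f: "f \<in> schwartz_pos" and g: "g \<in> schwartz_pos" and x: "x > 0"
  shows "continuous_on {0<..} (\<lambda>y. inverse y * f (x * inverse y) * g y)"
proof -
  have scaled: "continuous_on {0<..} (\<lambda>y. f (x * inverse y))"
  proof (rule continuous_on_compose2[OF schwartz_pos_continuous[OF f]])
    show "continuous_on {0<..} (\<lambda>y. x * inverse y)" by (intro continuous_intros) auto
  qed (use x in auto)
  have "continuous_on {0<..} (\<lambda>y::real. inverse y)" by (intro continuous_intros) auto
  from continuous_on_mult[OF continuous_on_mult[OF this scaled] schwartz_pos_continuous[OF g]]
  show ?thesis .
qed

lemma mellin_kernel_decaying:
  assumes f: "f \<in> schwartz_pos" and g: "g \<in> schwartz_pos" and x: "x > 0"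
  shows "rapidly_decaying (\<lambda>y. inverse y * f (x * inverse y) * g y)"
proof -
  obtain C where C: "\<And>u. u > 0 \<Longrightarrow> \<bar>f u\<bar> \<le> C"
    using rapidly_decaying_bounded[OF schwartz_pos_decaying[OF f]] by metis
  have "rapidly_decaying (\<lambda>y. f (x * inverse y) * (y powr (-1) * g y))"
    by (rule rapidly_decaying_bounded_mult[OF rapidly_decaying_powr_mult[OF schwartz_pos_decaying[OF g]]])
      (rule C, use x in simp)
  then show ?thesis
    by (rule rapidly_decaying_cong[THEN iffD1, rotated]) (simp add: powr_minus mult_ac)
qed

lemma mellin_kernel_integrable:
  assumes "f \<in> schwartz_pos" "g \<in> schwartz_pos" "x > 0"
  shows "set_integrable lborel {0<..} (\<lambda>y. inverse y * f (x * inverse y) * g y)"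
  by (rule rapidly_decaying_integrable[OF mellin_kernel_decaying[OF assms] mellin_kernel_continuous[OF assms]])

lemma mellin_conv_lincomb_left:
  assumes "f \<in> schwartz_pos" "g \<in> schwartz_pos" "k \<in> schwartz_pos"
  shows "((\<lambda>x. c * f x + g x) \<star> k) x = c * (f \<star> k) x + (g \<star> k) x"
proof (cases "x > 0")
  case True
  have "((\<lambda>x. c * f x + g x) \<star> k) x = (LINT y:{0<..}|lborel.
      c * (inverse y * f (x * inverse y) * k y) + inverse y * g (x * inverse y) * k y)"
    using True by (simp add: mellin_conv_def algebra_simps)
  also have "\<dots> = c * (f \<star> k) x + (g \<star> k) x"
    using True by (subst set_integral_add) (simp_all add: mellin_conv_def mellin_kernel_integrable assms)
  finally show ?thesis .
qed (simp add: mellin_conv_def)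

text \<open>
  For fixed \<open>x\<close>, the derivative of \<open>y \<mapsto> f(x/y) g(y)\<close> is the difference of the two integrands,
  because \<open>y\<close> times the derivative of \<open>f(x/y)\<close> is \<open>- (D f)(x/y)\<close>.
\<close>

lemma euler_conv_swap:
  assumes f: "f \<in> schwartz_pos" and g: "g \<in> schwartz_pos"
  shows "euler f \<star> g = f \<star> euler g"
proof
  fix x
  note ef = schwartz_pos_euler[OF f] and eg = schwartz_pos_euler[OF g]
  show "(euler f \<star> g) x = (f \<star> euler g) x"
  proof (cases "x > 0")
    case x: True
    have "(LINT y:{0<..}|lborel. inverse y * f (x * inverse y) * euler g y
        + (-1) * (inverse y * euler f (x * inverse y) * g y)) = 0"
    proof (rule integral_deriv_rapidly_decaying)
      fix y :: real assume y: "y > 0"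
      have f': "(f has_field_derivative deriv f (x * inverse y)) (at (x * inverse y))"
        using schwartz_pos_DERIV[OF f] x y by simp
      have "((\<lambda>y. x * inverse y) has_field_derivative x * (- (inverse y ^ Suc (Suc 0)))) (at y)"
        by (intro DERIV_cmult DERIV_inverse) (use y in auto)
      from DERIV_mult[OF DERIV_chain2[where g="\<lambda>y. x * inverse y", OF f' this] schwartz_pos_DERIV[OF g y]]
      show "((\<lambda>y. f (x * inverse y) * g y) has_field_derivative
          inverse y * f (x * inverse y) * euler g y + (-1) * (inverse y * euler f (x * inverse y) * g y)) (at y)"
        by (rule DERIV_cong) (use y in \<open>simp add: euler_def field_simps\<close>)
    next
      show "continuous_on {0<..} (\<lambda>y. inverse y * f (x * inverse y) * euler g y
          + (-1) * (inverse y * euler f (x * inverse y) * g y))"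
        using continuous_on_add[OF mellin_kernel_continuous[OF f eg x]
          continuous_on_mult[OF continuous_on_const mellin_kernel_continuous[OF ef g x]]] .
      show "rapidly_decaying (\<lambda>y. inverse y * f (x * inverse y) * euler g y
          + (-1) * (inverse y * euler f (x * inverse y) * g y))"
        by (rule rapidly_decaying_add[OF mellin_kernel_decaying[OF f eg x]
          rapidly_decaying_cmult[OF mellin_kernel_decaying[OF ef g x]]])
      have "rapidly_decaying (\<lambda>y. y powr 1 * (inverse y * f (x * inverse y) * g y))"
        by (rule rapidly_decaying_powr_mult[OF mellin_kernel_decaying[OF f g x]])
      then show "rapidly_decaying (\<lambda>y. f (x * inverse y) * g y)"
        by (rule rapidly_decaying_cong[THEN iffD1, rotated]) simp
    qed
    then have "(f \<star> euler g) x + (-1) * (euler f \<star> g) x = 0"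
      using set_integral_add(2)[OF mellin_kernel_integrable[OF f eg x]
          set_integrable_mult_right[OF mellin_kernel_integrable[OF ef g x], where a="-1"]] x
      by (simp add: mellin_conv_def set_integral_uminus mellin_kernel_integrable ef g)
    then show ?thesis by simp
  qed (simp add: mellin_conv_def)
qed

text \<open>The weight factors as \<open>x\<^sup>a = (x/y)\<^sup>a y\<^sup>a\<close>, one part for each function.\<close>

lemma mellin_conv_decaying:
  assumes f: "f \<in> schwartz_pos" and g: "g \<in> schwartz_pos"
  shows "rapidly_decaying (f \<star> g)"
  unfolding rapidly_decaying_def
proof
  fix a :: real
  obtain C where C: "\<And>u. u > 0 \<Longrightarrow> \<bar>u powr a * f u\<bar> \<le> C"
    using rapidly_decayingD[OF schwartz_pos_decaying[OF f]] by metis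
  define B where "B = (LINT y:{0<..}|lborel. C * (y powr (a - 1) * \<bar>g y\<bar>))"
  show "\<exists>C. \<forall>x>0. \<bar>x powr a * (f \<star> g) x\<bar> \<le> C"
  proof (intro exI allI impI)
    fix x :: real assume x: "x > 0"
    have "\<bar>x powr a * (f \<star> g) x\<bar> =
        norm (LINT y:{0<..}|lborel. x powr a * (inverse y * f (x * inverse y) * g y))"
      using x by (simp add: mellin_conv_def)
    also have "\<dots> \<le> B"
      unfolding B_def set_lebesgue_integral_def
    proof (rule Bochner_Integration.integral_norm_bound_integral)
      have "set_integrable lborel {0<..} (\<lambda>y. x powr a * (inverse y * f (x * inverse y) * g y))"
        by (intro set_integrable_mult_right mellin_kernel_integrable f g x)
      then show "integrable lborel (\<lambda>y. indicat_real {0<..} y *\<^sub>R (x powr a * (inverse y * f (x * inverse y) * g y)))"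
        unfolding set_integrable_def .
      have "set_integrable lborel {0<..} (\<lambda>y. C * (y powr (a - 1) * \<bar>g y\<bar>))"
        by (intro set_integrable_mult_right powr_mult_integrable rapidly_decaying_abs
            continuous_intros schwartz_pos_decaying schwartz_pos_continuous g)
      then show "integrable lborel (\<lambda>y. indicat_real {0<..} y *\<^sub>R (C * (y powr (a - 1) * \<bar>g y\<bar>)))"
        unfolding set_integrable_def .
      fix y :: real
      show "norm (indicat_real {0<..} y *\<^sub>R (x powr a * (inverse y * f (x * inverse y) * g y)))
          \<le> indicat_real {0<..} y *\<^sub>R (C * (y powr (a - 1) * \<bar>g y\<bar>))"
      proof (cases "y > 0")
        case y: True
        have "(x * inverse y) powr a = x powr a * y powr - a"
          using x y by (simp add: powr_mult powr_minus flip: inverse_powr)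
        then have "x powr a = (x * inverse y) powr a * y powr a"
          using y by (simp add: powr_minus)
        moreover have "y powr (a - 1) = y powr a * inverse y"
          using y by (simp add: powr_diff divide_inverse)
        ultimately have "\<bar>x powr a * (inverse y * f (x * inverse y) * g y)\<bar>
            = \<bar>(x * inverse y) powr a * f (x * inverse y)\<bar> * (y powr (a - 1) * \<bar>g y\<bar>)"
          using y by (simp add: abs_mult)
        also have "\<dots> \<le> C * (y powr (a - 1) * \<bar>g y\<bar>)"
          using C[of "x * inverse y"] x y by (intro mult_right_mono) auto
        finally show ?thesis using y by simp
      qed simp
    qed
    finally show "\<bar>x powr a * (f \<star> g) x\<bar> \<le> B" .
  qed
qed

text \<open>
  Differentiation under the integral.  The difference quotients of the integrand are dominated
  through the global Lipschitz bound for \<open>f\<close>: dividing the argument by \<open>y\<close> costs one more factor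
  \<open>1/y\<close>, which \<open>g\<close> absorbs.
\<close>

lemma mellin_conv_DERIV:
  assumes f: "f \<in> schwartz_pos" and g: "g \<in> schwartz_pos" and x: "x > 0"
  shows "((f \<star> g) has_field_derivative (euler f \<star> g) x / x) (at x)"
proof -
  define k where "k z y = inverse y * f (z * inverse y) * g y" for z y
  define D where "D y = inverse y * euler f (x * inverse y) * g y / x" for y
  obtain C where C: "\<And>u. u > 0 \<Longrightarrow> \<bar>deriv f u\<bar> \<le> C"
    using rapidly_decaying_bounded[OF schwartz_pos_deriv_decaying[OF f]] by metis
  have lipschitz: "\<bar>f u - f v\<bar> \<le> C * \<bar>u - v\<bar>" if "u > 0" "v > 0" for u v
    using field_differentiable_bound[of "{0<..}" f "deriv f" C u v] that
      schwartz_pos_DERIV[OF f] C by (auto intro: has_field_derivative_at_within)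
  have "((\<lambda>z. ((f \<star> g) z - (f \<star> g) x) / (z - x)) \<longlongrightarrow> (euler f \<star> g) x / x) (at x within {0<..})"
    unfolding tendsto_at_iff_sequentially
  proof (intro allI impI)
    fix X assume X: "\<forall>i. X i \<in> {0<..} - {x}" and X_lim: "X \<longlonglongrightarrow> x"
    have X_pos: "X i > 0" and X_ne: "X i \<noteq> x" for i using X by auto
    define q where "q i y = (k (X i) y - k x y) / (X i - x)" for i y
    have k_int: "set_integrable lborel {0<..} (k z)" if "z > 0" for z
      unfolding k_def using that by (intro mellin_kernel_integrable f g)
    have q_int: "set_integrable lborel {0<..} (q i)" for i
      unfolding q_def[abs_def] by (intro set_integrable_divide set_integral_diff k_int x X_pos)
    have D_int: "set_integrable lborel {0<..} D"
      unfolding D_def[abs_def]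
      by (intro set_integrable_divide mellin_kernel_integrable schwartz_pos_euler f g x)
    have "(\<lambda>i. LINT y:{0<..}|lborel. q i y) \<longlonglongrightarrow> (LINT y:{0<..}|lborel. D y)"
      unfolding set_lebesgue_integral_def
    proof (rule integral_dominated_convergence)
      show "(\<lambda>y. indicat_real {0<..} y *\<^sub>R D y) \<in> borel_measurable lborel"
        using D_int unfolding set_integrable_def by (rule borel_measurable_integrable)
      show "(\<lambda>y. indicat_real {0<..} y *\<^sub>R q i y) \<in> borel_measurable lborel" for i
        using q_int[of i] unfolding set_integrable_def by (rule borel_measurable_integrable)
      have "set_integrable lborel {0<..} (\<lambda>y. C * (y powr (-2) * \<bar>g y\<bar>))"
        by (intro set_integrable_mult_right powr_mult_integrable rapidly_decaying_abs
            continuous_intros schwartz_pos_decaying schwartz_pos_continuous g)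
      then show "integrable lborel (\<lambda>y. indicat_real {0<..} y *\<^sub>R (C * (y powr (-2) * \<bar>g y\<bar>)))"
        unfolding set_integrable_def .
      show "AE y in lborel. norm (indicat_real {0<..} y *\<^sub>R q i y)
          \<le> indicat_real {0<..} y *\<^sub>R (C * (y powr (-2) * \<bar>g y\<bar>))" for i
      proof (intro AE_I2)
        fix y :: real
        show "norm (indicat_real {0<..} y *\<^sub>R q i y) \<le> indicat_real {0<..} y *\<^sub>R (C * (y powr (-2) * \<bar>g y\<bar>))"
        proof (cases "y > 0")
          case y: True
          have "\<bar>f (X i * inverse y) - f (x * inverse y)\<bar> \<le> C * \<bar>X i * inverse y - x * inverse y\<bar>"
            using x y X_pos by (intro lipschitz) auto
          also have "X i * inverse y - x * inverse y = (X i - x) * inverse y"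
            by (simp add: algebra_simps)
          finally have "\<bar>f (X i * inverse y) - f (x * inverse y)\<bar> / \<bar>X i - x\<bar> \<le> C * inverse y"
            using y X_ne[of i] by (simp add: abs_mult divide_simps mult_ac)
          then have "\<bar>f (X i * inverse y) - f (x * inverse y)\<bar> / \<bar>X i - x\<bar> * (inverse y * \<bar>g y\<bar>)
              \<le> C * inverse y * (inverse y * \<bar>g y\<bar>)"
            using y by (intro mult_right_mono) auto
          moreover have "q i y = (f (X i * inverse y) - f (x * inverse y)) / (X i - x) * (inverse y * g y)"
            unfolding q_def k_def by (simp add: divide_inverse algebra_simps)
          moreover have "y powr (-2) = inverse y * inverse y"
            using y by (simp add: powr_minus power2_eq_square)
          ultimately show ?thesis using y by (simp add: abs_mult mult_ac)
        qed simp
      qed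
      show "AE y in lborel. (\<lambda>i. indicat_real {0<..} y *\<^sub>R q i y) \<longlonglongrightarrow> indicat_real {0<..} y *\<^sub>R D y"
      proof (intro AE_I2)
        fix y :: real
        show "(\<lambda>i. indicat_real {0<..} y *\<^sub>R q i y) \<longlonglongrightarrow> indicat_real {0<..} y *\<^sub>R D y"
        proof (cases "y > 0")
          case y: True
          have f': "(f has_field_derivative deriv f (x * inverse y)) (at (x * inverse y))"
            using schwartz_pos_DERIV[OF f] x y by simp
          have "((\<lambda>z. z * inverse y) has_field_derivative 1 * inverse y) (at x)"
            by (intro DERIV_cmult_right DERIV_ident)
          have "((\<lambda>z. k z y) has_field_derivative inverse y * (deriv f (x * inverse y) * (1 * inverse y)) * g y) (at x)"
            unfolding k_def
            by (rule DERIV_cmult_right[OF DERIV_cmult[OF DERIV_chain2[where g="\<lambda>z. z * inverse y", OF f' \<open>((\<lambda>z. z * inverse y) has_field_derivative 1 * inverse y) (at x)\<close>]]])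
          then have "((\<lambda>z. k z y) has_field_derivative D y) (at x)"
            by (rule DERIV_cong) (use x in \<open>simp add: D_def euler_def\<close>)
          then have "((\<lambda>z. (k z y - k x y) / (z - x)) \<longlongrightarrow> D y) (at x)"
            by (simp add: has_field_derivative_iff)
          then have "(\<lambda>i. q i y) \<longlonglongrightarrow> D y"
            using X_lim X_ne unfolding tendsto_at_iff_sequentially q_def by (auto simp: o_def)
          then show ?thesis using y by simp
        qed simp
      qed
    qed
    also have "(\<lambda>i. LINT y:{0<..}|lborel. q i y) = (\<lambda>z. ((f \<star> g) z - (f \<star> g) x) / (z - x)) \<circ> X"
    proof
      fix i
      have "(LINT y:{0<..}|lborel. q i y) =
          ((LINT y:{0<..}|lborel. k (X i) y) - (LINT y:{0<..}|lborel. k x y)) / (X i - x)"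
        unfolding q_def[abs_def] set_integral_divide_zero
        by (subst set_integral_diff) (simp_all add: k_int x X_pos)
      then show "(LINT y:{0<..}|lborel. q i y) = ((\<lambda>z. ((f \<star> g) z - (f \<star> g) x) / (z - x)) \<circ> X) i"
        using x X_pos[of i] by (simp add: mellin_conv_def k_def)
    qed
    also have "(LINT y:{0<..}|lborel. D y) = (euler f \<star> g) x / x"
      using x unfolding D_def[abs_def] set_integral_divide_zero by (simp add: mellin_conv_def)
    finally show "((\<lambda>z. ((f \<star> g) z - (f \<star> g) x) / (z - x)) \<circ> X) \<longlonglongrightarrow> (euler f \<star> g) x / x" .
  qed
  then have "((f \<star> g) has_field_derivative (euler f \<star> g) x / x) (at x within {0<..})"
    by (simp add: has_field_derivative_iff)
  then show ?thesis using x by (simp add: at_within_open[of x "{0<..}"])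
qed

lemma schwartz_pos_mellin_conv:
  assumes f: "f \<in> schwartz_pos" and g: "g \<in> schwartz_pos"
  shows "f \<star> g \<in> schwartz_pos"
proof (rule schwartz_pos_coinduct[of _ "(\<lambda>f. f \<star> g) ` schwartz_pos"])
  fix F assume "F \<in> (\<lambda>f. f \<star> g) ` schwartz_pos"
  then obtain u where F: "F = u \<star> g" and u: "u \<in> schwartz_pos" by blast
  show "F x = 0" if "x \<le> 0" for x using that by (simp add: F mellin_conv_def)
  show "F field_differentiable at x" if "x > 0" for x
    unfolding F field_differentiable_def using mellin_conv_DERIV[OF u g that] by blast
  show "rapidly_decaying F" unfolding F by (rule mellin_conv_decaying[OF u g])
  fix n
  have eu: "euler u \<in> schwartz_pos" by (rule schwartz_pos_euler[OF u])
  have mem: "(\<lambda>x. - real n * u x + euler u x) \<star> g \<in> (\<lambda>f. f \<star> g) ` schwartz_pos"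
    by (intro imageI schwartz_pos_lincomb u eu)
  show "\<exists>H\<in>(\<lambda>f. f \<star> g) ` schwartz_pos. \<forall>x>0. H x = euler F x - real n * F x"
    by (rule bexI[OF _ mem], unfold mellin_conv_lincomb_left[OF u eu g])
      (use DERIV_imp_deriv[OF mellin_conv_DERIV[OF u g]] in \<open>simp add: F euler_def[of "u \<star> g"]\<close>)
qed (use f in blast)

text \<open>
  Substituting \<open>x = y u\<close>: the weight is a character of the multiplicative group, so a dilation
  only contributes the factor \<open>y powr s\<close>.  This is why Fubini's theorem makes the Mellin transform
  multiplicative.
\<close>

lemma mellin_dilation:
  fixes \<phi> :: "real \<Rightarrow> real"
  assumes y: "y > 0"
  shows "(LINT x:{0<..}|lborel. x powr (s - 1) * \<phi> (x * inverse y)) =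
      y powr s * (LINT u:{0<..}|lborel. u powr (s - 1) * \<phi> u)" (is ?eq)
    and "set_integrable lborel {0<..} (\<lambda>u. u powr (s - 1) * \<phi> u) \<Longrightarrow>
      set_integrable lborel {0<..} (\<lambda>x. x powr (s - 1) * \<phi> (x * inverse y))" (is "?i1 \<Longrightarrow> ?i2")
proof -
  define H where "H x = indicat_real {0<..} x *\<^sub>R (x powr (s - 1) * \<phi> (x * inverse y))" for x
  have H: "H (0 + y * u) = y powr (s - 1) * (indicat_real {0<..} u *\<^sub>R (u powr (s - 1) * \<phi> u))" for u
  proof -
    have "y * u * inverse y = u" using y by simp
    show ?thesis using y by (auto simp: H_def indicator_def powr_mult zero_less_mult_iff \<open>y * u * inverse y = u\<close>)
  qed
  have "(\<integral>x. H x \<partial>lborel) = y * (\<integral>u. H (0 + y * u) \<partial>lborel)"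
    using lborel_integral_real_affine[of y H 0] y by simp
  also have "\<dots> = y powr s * (LINT u:{0<..}|lborel. u powr (s - 1) * \<phi> u)"
    unfolding H set_lebesgue_integral_def using y powr_mult_base[of y "s - 1"] by simp
  finally show ?eq unfolding H_def set_lebesgue_integral_def .
  assume ?i1
  then have "integrable lborel (\<lambda>u. H (0 + y * u))"
    unfolding H set_integrable_def by (rule integrable_mult_right)
  then have "integrable lborel H"
    using lborel_integrable_real_affine_iff[of y H 0] y by simp
  then show ?i2 unfolding H_def[abs_def] set_integrable_def .
qed

lemma mellin_mellin_conv:
  assumes f: "f \<in> schwartz_pos" and g: "g \<in> schwartz_pos"
  shows "mellin s (f \<star> g) = mellin s f * mellin s g"
proof -
  note [measurable] = schwartz_pos_measurable[OF f] schwartz_pos_measurable[OF g]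
  define G where "G y x = indicat_real {0<..} y * (inverse y * g y) *
      (indicat_real {0<..} x * (x powr (s - 1) * f (x * inverse y)))" for y x
  define M where "M = (LINT u:{0<..}|lborel. u powr (s - 1) * \<bar>f u\<bar>)"
  have powr_inverse: "y powr s = y * y powr (s - 1)" if "y > 0" for y :: real
    using that by (simp add: powr_diff)
  have G_int: "integrable (lborel \<Otimes>\<^sub>M lborel) (case_prod G)"
  proof (rule lborel_pair.Fubini_integrable)
    show "case_prod G \<in> borel_measurable (lborel \<Otimes>\<^sub>M lborel)"
      unfolding G_def case_prod_beta' by measurable
    have "set_integrable lborel {0<..} (\<lambda>y. M * (y powr (s - 1) * \<bar>g y\<bar>))"
      by (intro set_integrable_mult_right powr_mult_integrable rapidly_decaying_abs
          continuous_intros schwartz_pos_decaying schwartz_pos_continuous g)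
    moreover have "indicat_real {0<..} y *\<^sub>R (M * (y powr (s - 1) * \<bar>g y\<bar>)) =
        (\<integral>x. norm (case (y, x) of (y, x) \<Rightarrow> G y x) \<partial>lborel)" for y
    proof (cases "y > 0")
      case y: True
      have "(\<integral>x. norm (G y x) \<partial>lborel) = inverse y * \<bar>g y\<bar> *
          (LINT x:{0<..}|lborel. x powr (s - 1) * \<bar>f (x * inverse y)\<bar>)"
        unfolding G_def set_lebesgue_integral_def using y by (simp add: abs_mult)
      also have "\<dots> = M * (y powr (s - 1) * \<bar>g y\<bar>)"
        using mellin_dilation(1)[OF y, of s "\<lambda>u. \<bar>f u\<bar>"] y by (simp add: M_def powr_inverse)
      finally show ?thesis using y by simp
    qed (simp add: G_def)
    ultimately show "integrable lborel (\<lambda>y. \<integral>x. norm (case (y, x) of (y, x) \<Rightarrow> G y x) \<partial>lborel)"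
      unfolding set_integrable_def by simp
    have "integrable lborel (\<lambda>x. G y x)" for y
    proof (cases "y > 0")
      case True
      have "set_integrable lborel {0<..} (\<lambda>x. x powr (s - 1) * f (x * inverse y))"
        by (rule mellin_dilation(2)[OF True mellin_integrable[OF f]])
      then show ?thesis
        unfolding G_def set_integrable_def by (intro integrable_mult_right) simp
    qed (simp add: G_def)
    then show "AE y in lborel. integrable lborel (\<lambda>x. case (y, x) of (y, x) \<Rightarrow> G y x)" by simp
  qed
  have "mellin s (f \<star> g) = (\<integral>x. \<integral>y. G y x \<partial>lborel \<partial>lborel)"
    unfolding mellin_def set_lebesgue_integral_def
  proof (rule Bochner_Integration.integral_cong[OF refl])
    fix x :: real
    have "(\<integral>y. G y x \<partial>lborel) = (\<integral>y. (indicat_real {0<..} x * x powr (s - 1)) *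
        (indicat_real {0<..} y *\<^sub>R (inverse y * f (x * inverse y) * g y)) \<partial>lborel)"
      by (simp add: G_def mult_ac)
    then show "indicat_real {0<..} x *\<^sub>R (x powr (s - 1) * (f \<star> g) x) = (\<integral>y. G y x \<partial>lborel)"
      by (simp add: mellin_conv_def set_lebesgue_integral_def indicator_def)
  qed
  also have "\<dots> = (\<integral>y. \<integral>x. G y x \<partial>lborel \<partial>lborel)"
    using lborel_pair.Fubini_integral[OF G_int] .
  also have "\<dots> = (LINT y:{0<..}|lborel. mellin s f * (y powr (s - 1) * g y))"
    unfolding set_lebesgue_integral_def[of lborel "{0<..}" "\<lambda>y. mellin s f * (y powr (s - 1) * g y)"]
  proof (rule Bochner_Integration.integral_cong[OF refl])
    fix y :: real
    show "(\<integral>x. G y x \<partial>lborel) = indicat_real {0<..} y *\<^sub>R (mellin s f * (y powr (s - 1) * g y))"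
    proof (cases "y > 0")
      case y: True
      have "(\<integral>x. G y x \<partial>lborel) =
          inverse y * g y * (LINT x:{0<..}|lborel. x powr (s - 1) * f (x * inverse y))"
        unfolding G_def set_lebesgue_integral_def using y by simp
      also have "\<dots> = mellin s f * (y powr (s - 1) * g y)"
        using mellin_dilation(1)[OF y, of s f] y by (simp add: mellin_def powr_inverse)
      finally show ?thesis using y by simp
    qed (simp add: G_def)
  qed
  also have "\<dots> = mellin s f * mellin s g" by (simp add: mellin_def)
  finally show ?thesis .
qed

section \<open>Characters of the convolution algebra\<close>

lemma
  assumes m: "m \<in> structure_space"
  shows character_nonzero: "\<exists>e\<in>schwartz_pos. m e \<noteq> 0"
    and character_add: "\<forall>f\<in>schwartz_pos. \<forall>g\<in>schwartz_pos. m (\<lambda>x. f x + g x) = m f + m g"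
    and character_scale: "\<forall>c. \<forall>f\<in>schwartz_pos. m (\<lambda>x. c * f x) = c * m f"
    and character_mult: "\<forall>f\<in>schwartz_pos. \<forall>g\<in>schwartz_pos. m (f \<star> g) = m f * m g"
  using m unfolding structure_space_def mem_Collect_eq by - (elim conjE, assumption)+

lemma character_lincomb:
  assumes m: "m \<in> structure_space" and f: "f \<in> schwartz_pos" and g: "g \<in> schwartz_pos"
  shows "m (\<lambda>x. c * f x + g x) = c * m f + m g"
proof -
  have cf: "(\<lambda>x. c * f x) \<in> schwartz_pos"
    using schwartz_pos_lincomb[OF f zero_in_schwartz_pos, of c] by simp
  have "m (\<lambda>x. c * f x + g x) = m (\<lambda>x. c * f x) + m g"
    by (rule character_add[OF m, THEN bspec, OF cf, THEN bspec, OF g])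
  also have "m (\<lambda>x. c * f x) = c * m f"
    by (rule character_scale[OF m, THEN spec, THEN bspec, OF f])
  finally show ?thesis .
qed

text \<open>
  Apply the character to \<open>D f \<star> e = f \<star> D e\<close>.  The point is that the eigenvalue is given by
  evaluations of \<open>m\<close> at the two fixed functions \<open>e\<close> and \<open>D e\<close>.
\<close>

lemma character_euler_eigenvalue:
  assumes m: "m \<in> structure_space" and e: "e \<in> schwartz_pos" "m e \<noteq> 0" and f: "f \<in> schwartz_pos"
  shows "m (euler f) = m (euler e) / m e * m f"
proof -
  have "m (euler f) * m e = m f * m (euler e)"
    using character_mult[OF m, THEN bspec, OF schwartz_pos_euler[OF f], THEN bspec, OF e(1)]
      character_mult[OF m, THEN bspec, OF f, THEN bspec, OF schwartz_pos_euler[OF e(1)]]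
    unfolding euler_conv_swap[OF f e(1)] by (rule trans[OF sym])
  then show ?thesis using e(2) by (simp add: field_simps)
qed

text \<open>
  A linear functional whose kernel contains that of the Mellin transform is a multiple of it, and
  multiplicativity normalises the factor to 1.
\<close>

lemma character_eq_mellin:
  assumes m: "m \<in> structure_space" and e: "e \<in> schwartz_pos" "m e \<noteq> 0" and f: "f \<in> schwartz_pos"
  shows "m f = mellin (- (m (euler e) / m e)) f"
proof -
  define s where "s = - (m (euler e) / m e)"
  \<comment> \<open>\<open>u\<close> lies in the range of \<open>D + s\<close>, on which \<open>m\<close> vanishes by the eigenvalue equation.\<close>
  have kernel: "m u = 0" if u: "u \<in> schwartz_pos" "mellin s u = 0" for u
  proof -
    obtain h where h: "h \<in> schwartz_pos" "\<And>x. u x = euler h x + s * h x"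
      using euler_inhomogeneous_solution[OF u] by metis
    have "u = (\<lambda>x. s * h x + euler h x)" by (rule ext) (simp add: h(2))
    then have "m u = s * m h + m (euler h)"
      by (simp only: character_lincomb[OF m h(1) schwartz_pos_euler[OF h(1)]])
    also have "\<dots> = 0"
      unfolding character_euler_eigenvalue[where m=m and e=e and f=h, OF m e h(1)] s_def by simp
    finally show ?thesis .
  qed
  have ne: "mellin s e \<noteq> 0" using kernel[OF e(1)] e(2) by blast
  define c where "c = m e / mellin s e"
  have proportional: "m u = c * mellin s u" if u: "u \<in> schwartz_pos" for u
  proof -
    \<comment> \<open>Correct \<open>u\<close> by a multiple of \<open>e\<close> so that its Mellin transform at \<open>s\<close> vanishes.\<close>
    let ?d = "- (mellin s u / mellin s e)"
    have "mellin s (\<lambda>x. ?d * e x + u x) = 0"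
      unfolding mellin_lincomb[OF e(1) u] using ne by simp
    then have "m (\<lambda>x. ?d * e x + u x) = 0"
      by (rule kernel[OF schwartz_pos_lincomb[OF e(1) u]])
    then have "?d * m e + m u = 0" unfolding character_lincomb[OF m e(1) u] .
    then show ?thesis by (simp add: c_def)
  qed
  have "m (e \<star> e) = m e * m e" 
    by (rule character_mult[OF m, THEN bspec, OF e(1), THEN bspec, OF e(1)])
  then have "c * (mellin s e * mellin s e) = (c * mellin s e) * (c * mellin s e)"
    using proportional[OF schwartz_pos_mellin_conv[OF e(1) e(1)]] proportional[OF e(1)]
      mellin_mellin_conv[OF e(1) e(1)] by simp
  moreover have "c \<noteq> 0" using ne e(2) by (simp add: c_def)
  ultimately have "c = 1" using ne by simp
  then show ?thesis using proportional[OF f] by (simp add: s_def)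
qed

text \<open>
  The parameter is unique because the eigenvalue of the Euler operator recovers it.
\<close>

lemma omega_eq_quotient:
  assumes m: "m \<in> structure_space" and e: "e \<in> schwartz_pos" "m e \<noteq> 0"
  shows "omega m = - (m (euler e) / m e)"
proof -
  have "omega m = (THE s. \<forall>f\<in>schwartz_pos. m f = mellin s f)"
    by (simp add: omega_def mellin_def)
  also have "\<dots> = - (m (euler e) / m e)"
  proof (rule the_equality)
    show "\<forall>f\<in>schwartz_pos. m f = mellin (- (m (euler e) / m e)) f"
      by (intro ballI character_eq_mellin[where m=m and e=e, OF m e])
    show "s = - (m (euler e) / m e)" if s: "\<forall>f\<in>schwartz_pos. m f = mellin s f" for s
    proof -
      have "m (euler e) = - s * m e"
        using s e(1) schwartz_pos_euler[OF e(1)] mellin_euler[OF e(1)] by simp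
      then show ?thesis using e(2) by simp
    qed
  qed
  finally show ?thesis .
qed

theorem theorem16:
  shows "continuous_map weak_star_topology euclideanreal omega"
  unfolding continuous_map_atin topspace_weak_star_topology limitin_canonical_iff
proof (rule ballI)
  fix m0 assume m0: "m0 \<in> structure_space"
  obtain e where e: "e \<in> schwartz_pos" "m0 e \<noteq> 0"
    using character_nonzero[OF m0] by (rule bexE)
  let ?F = "atin weak_star_topology m0"
  have eval: "((\<lambda>m. m f) \<longlongrightarrow> m0 f) ?F" if "f \<in> schwartz_pos" for f
    using continuous_map_weak_star_eval[OF that] m0
    unfolding continuous_map_atin topspace_weak_star_topology limitin_canonical_iff by blast
  have "((\<lambda>m. - (m (euler e) / m e)) \<longlongrightarrow> - (m0 (euler e) / m0 e)) ?F"
    by (rule tendsto_minus[OF tendsto_divide[OF eval[OF schwartz_pos_euler[OF e(1)]] eval[OF e(1)] e(2)]])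
  moreover have "\<forall>\<^sub>F m in ?F. - (m (euler e) / m e) = omega m"
  proof -
    have "\<forall>\<^sub>F m in ?F. m \<in> structure_space"
      unfolding eventually_atin
      using m0 openin_topspace[of weak_star_topology] by (auto simp: topspace_weak_star_topology)
    moreover have "\<forall>\<^sub>F m in ?F. m e \<noteq> 0"
      by (rule tendsto_imp_eventually_ne[OF eval[OF e(1)] e(2)])
    ultimately show ?thesis
      by eventually_elim (rule omega_eq_quotient[where e=e, OF _ e(1), symmetric])
  qed
  ultimately show "(omega \<longlongrightarrow> omega m0) ?F"
    unfolding omega_eq_quotient[where m=m0 and e=e, OF m0 e] by (rule Lim_transform_eventually)
qed

end
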